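(* Let $p$ be an odd prime, and let $m\in\mathbb{Z}_p$ with $m\not\equiv 0\pmod p$. Then $$\sum_{n=0}^{p-1}\frac{\binom{2n}{n}G_n}{m^n}\equiv\sum_{k=0}^{(p-1)/2}\binom{2k}{k}^2\binom{4k}{2k}\Big(\frac{m-64}{m^2}\Big)^k\equiv\Big(\sum_{k=0}^{p-1}\frac{\binom{2k}{k}\binom{4k}{2k}}{m^k}\Big)^2\pmod{p^2}.$$
   Context: $\mathbb{Z}_p$ denotes the set of rational numbers whose denominator is not divisible by $p$; congruences are in this ring. For $n\ge0$, $G_n=\sum_{k=0}^n \binom{2k}{k}^2\binom{2n-2k}{n-k}4^{n-k}$. *)

theory Defs
  imports Complex_Main "HOL-Computational_Algebra.Primes"
begin

text \<open>The ring of rationals whose denominator (in lowest terms) is not divisible by \<open>p\<close>.\<close>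
definition Zp :: "nat \<Rightarrow> rat set" where
  "Zp p = {x. \<not> int p dvd snd (quotient_of x)}"

text \<open>Congruence modulo the ideal generated by \<open>n\<close> in the ring \<open>Zp p\<close>; both sides are
  required to be elements of the ring.\<close>
definition Zp_cong :: "nat \<Rightarrow> nat \<Rightarrow> rat \<Rightarrow> rat \<Rightarrow> bool" where
  "Zp_cong p n x y \<longleftrightarrow> x \<in> Zp p \<and> y \<in> Zp p \<and> (\<exists>z\<in>Zp p. x - y = of_nat n * z)"

definition G :: "nat \<Rightarrow> nat" where
  "G n = (\<Sum>k=0..n. ((2*k) choose k)^2 * ((2*n - 2*k) choose (n - k)) * 4^(n - k))"

end

theory Submission
  imports Defs
begin

text \<open>
  Put \<open>a k = (2k choose k) (4k choose 2k)\<close> and \<open>c k = (2k choose k)\<^sup>2 (4k choose 2k)\<close>. The numbers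
  \<open>(2n choose n) G n\<close>, the coefficients of \<open>(\<Sum> a k x^k)\<^sup>2\<close> and those of
  \<open>\<Sum> c k (x (1 - 64 x))^k\<close> satisfy the same second-order recurrence (found by creative
  telescoping), so they coincide. With \<open>x = 1/m\<close> one has \<open>x (1 - 64 x) = (m - 64)/m\<^sup>2\<close>, and
  truncating the three series as in the theorem only drops or adds terms divisible by \<open>p\<^sup>2\<close>:
  \<open>c k\<close> with \<open>p/2 < k < p\<close>, and \<open>a i * a j\<close> with \<open>i, j < p \<le> i + j\<close>.
\<close>

section \<open>Zero extension and summation by telescoping\<close>

text \<open>Extension by zero to negative indices lets the recurrences of the summands, and hence the
  telescoping identities, hold without boundary cases.\<close>
definition zext :: "(nat \<Rightarrow> int) \<Rightarrow> int \<Rightarrow> int" where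
  "zext f i = (if i < 0 then 0 else f (nat i))"

lemma zext_of_nat [simp]: "zext f (int n) = f n"
  by (simp add: zext_def)

lemma zext_neg [simp]: "i < 0 \<Longrightarrow> zext f i = 0"
  by (simp add: zext_def)

text \<open>The only boundary case is \<open>i = -1\<close>: the right side is zero and the left
  side is \<open>P 0 * f 0\<close>, so \<open>P 0 = 0\<close> is what carries the recurrence to all
  integers.\<close>

lemma zext_first_order:
  assumes "\<And>n. P (int n + 1) * f (Suc n) = Q (int n) * f n" and "P 0 = (0::int)"
  shows "P (i + 1) * zext f (i + 1) = Q i * zext f i"
proof (cases "i < 0")
  case True
  then show ?thesis using assms(2) by (cases "i = -1") auto
next
  case False
  then obtain n where "i = int n" by (metis nonneg_int_cases not_less)
  then show ?thesis using assms(1)[of n] zext_of_nat[of f "Suc n"] by (simp add: add.commute)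
qed

text \<open>The terms with \<open>k > n\<close> are zero, so convolutions of different lengths can
  be written over one common range and combined termwise.\<close>

lemma sum_zext:
  assumes "n < M"
  shows "(\<Sum>k<M. zext (F k) (int n - int k)) = (\<Sum>k\<le>n. F k (n - k))"
proof -
  have "(\<Sum>k<M. zext (F k) (int n - int k)) = (\<Sum>k\<le>n. zext (F k) (int n - int k))"
    by (rule sum.mono_neutral_right) (use assms in auto)
  also have "\<dots> = (\<Sum>k\<le>n. F k (n - k))"
    by (rule sum.cong) (auto simp flip: of_nat_diff)
  finally show ?thesis .
qed

lemma creative_telescoping:
  fixes F :: "nat \<Rightarrow> nat \<Rightarrow> int"
  assumes "\<And>k. P2 * zext (F k) (int n - int k + 2) - P1 * zext (F k) (int n - int k + 1)
              + P0 * zext (F k) (int n - int k) = S (Suc k) - S k"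
    and "S 0 = 0" and "S (n + 3) = 0"
  shows "P2 * (\<Sum>k\<le>n+2. F k (n + 2 - k)) =
         P1 * (\<Sum>k\<le>n+1. F k (n + 1 - k)) - P0 * (\<Sum>k\<le>n. F k (n - k))"
proof -
  have "P2 * (\<Sum>k<n+3. zext (F k) (int (n+2) - int k))
      - P1 * (\<Sum>k<n+3. zext (F k) (int (n+1) - int k))
      + P0 * (\<Sum>k<n+3. zext (F k) (int n - int k))
      = (\<Sum>k<n+3. S (Suc k) - S k)"
    unfolding sum_distrib_left sum.distrib[symmetric] sum_subtractf[symmetric]
    by (rule sum.cong) (auto simp: assms(1)[symmetric] algebra_simps)
  also have "\<dots> = 0"
    using assms(2,3) by (simp add: sum_lessThan_telescope)
  finally show ?thesis
    by (subst (asm) (1 2 3) sum_zext) simp_all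
qed

section \<open>First-order recurrences of the coefficients\<close>

abbreviation cbin :: "nat \<Rightarrow> int" where
  "cbin k \<equiv> int ((2 * k) choose k)"

text \<open>Coefficients of the hypergeometric series 2F1(1/4, 3/4; 1; 64 x).\<close>

definition qa :: "nat \<Rightarrow> int" where
  "qa k = cbin k * cbin (2 * k)"

text \<open>Coefficients of 3F2(1/4, 1/2, 3/4; 1, 1; 256 x).\<close>

definition qc :: "nat \<Rightarrow> int" where
  "qc k = cbin k ^ 2 * cbin (2 * k)"

lemma cbin_Suc: "(int k + 1) * cbin (Suc k) = 2 * (2 * int k + 1) * cbin k"
proof -
  have "Suc k * ((2 * Suc k) choose Suc k) = 2 * Suc k * ((2 * k + 1) choose k)"
    using Suc_times_binomial_eq[of "2 * k + 1" k] by (simp add: mult.commute)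
  moreover have "Suc k * ((2 * k + 1) choose k) = (2 * k + 1) * ((2 * k) choose k)"
    using Suc_times_binomial_eq[of "2 * k" k] binomial_symmetric[of k "2 * k + 1"]
    by (simp add: mult.commute)
  ultimately have "Suc k * ((2 * Suc k) choose Suc k) = 2 * ((2 * k + 1) * ((2 * k) choose k))"
    by (metis mult.assoc)
  from arg_cong[OF this, of int] show ?thesis
    by (simp add: algebra_simps del: binomial_Suc_Suc)
qed

lemma cbin_double_Suc:
  "(2 * int k + 1) * (int k + 1) * cbin (2 * Suc k) = 2 * (4 * int k + 1) * (4 * int k + 3) * cbin (2 * k)"
proof -
  have 1: "(2 * int k + 1) * cbin (Suc (2 * k)) = 2 * (4 * int k + 1) * cbin (2 * k)"
    using cbin_Suc[of "2 * k"] by simp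
  have "(2 * int k + 2) * cbin (2 * Suc k) = 2 * (4 * int k + 3) * cbin (Suc (2 * k))"
    using cbin_Suc[of "Suc (2 * k)"] by (simp add: algebra_simps)
  then have "(int k + 1) * cbin (2 * Suc k) = (4 * int k + 3) * cbin (Suc (2 * k))"
    by algebra
  with 1 show ?thesis by algebra
qed

lemma qa_Suc: "(int k + 1)^2 * qa (Suc k) = 4 * (4 * int k + 1) * (4 * int k + 3) * qa k"
proof -
  \<comment> \<open>\<open>cbin_double_Suc\<close> brings in the extra factor
    \<open>2 * int k + 1\<close>, so the recurrence is first proved multiplied by it.\<close>
  have "(2 * int k + 1) * ((int k + 1)^2 * qa (Suc k))
      = (2 * int k + 1) * (4 * (4 * int k + 1) * (4 * int k + 3) * qa k)"
    using cbin_Suc[of k] cbin_double_Suc[of k] unfolding qa_def by algebra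
  moreover have "2 * int k + 1 \<noteq> 0" by presburger
  ultimately show ?thesis by (metis mult_left_cancel)
qed

lemma qc_Suc:
  "(int k + 1)^3 * qc (Suc k) = 8 * (2 * int k + 1) * (4 * int k + 1) * (4 * int k + 3) * qc k"
proof -
  have c: "qc j = cbin j * qa j" for j by (simp add: qc_def qa_def power2_eq_square)
  show ?thesis using cbin_Suc[of k] qa_Suc[of k] unfolding c by algebra
qed

section \<open>The second-order recurrence shared by the three sequences\<close>

lemma qa_convolution_rec:
  defines "D \<equiv> \<lambda>n. \<Sum>k\<le>n. qa k * qa (n - k)"
  shows "(int n + 2)^3 * D (n + 2)
    = 2 * (2 * int n + 3) * (32 * (int n + 1) * (int n + 2) + 12) * D (n + 1)
      - 1024 * (int n + 1) * (2 * int n + 1) * (2 * int n + 3) * D n"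
  unfolding D_def
proof (rule creative_telescoping)
  \<comment> \<open>The factor \<open>int k ^ 2\<close> gives \<open>?S 0 = 0\<close> and lets
    \<open>qa_Suc\<close> rewrite \<open>?S (Suc k)\<close>; at \<open>n + 3\<close> both extended
    arguments are negative. The linear factor \<open>2 * int k - 3 * (int n + 2)\<close> is chosen
    because, with N = n + 2, N^3 - 3 N k^2 + 2 k^3 = (N - k)^2 (N + 2 k): the coefficient of
    \<open>zext qa (j + 2)\<close> becomes a multiple of \<open>(j + 2)^2\<close>, so the recurrence
    applies without division.\<close>
  let ?S = "\<lambda>k. int k ^ 2 * qa k *
     ((2 * int k - 3 * (int n + 2)) * zext qa (int n - int k + 2)
      + 64 * (3 * int n + 4 - 2 * int k) * zext qa (int n - int k + 1))"
  have z: "zext (\<lambda>j. qa k * qa j) i = qa k * zext qa i" for k i by (simp add: zext_def)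
  fix k
  define j where "j = int n - int k"
  have n: "int n = j + int k" by (simp add: j_def)
  have rec: "(i + 1)^2 * zext qa (i + 1) = 4 * (4 * i + 1) * (4 * i + 3) * zext qa i" for i
    by (rule zext_first_order[where P = "\<lambda>x. x^2" and Q = "\<lambda>i. 4 * (4 * i + 1) * (4 * i + 3)"])
       (simp_all add: qa_Suc)
  have "?S (Suc k) = (int k + 1)^2 * qa (Suc k) * ((2 * (int k + 1) - 3 * (j + int k + 2)) * zext qa (j + 1)
      + 64 * (3 * j + int k + 2) * zext qa j)"
    by (simp add: n algebra_simps)
  also have "\<dots> = 4 * (4 * int k + 1) * (4 * int k + 3) * qa k * ((2 * (int k + 1) - 3 * (j + int k + 2)) * zext qa (j + 1)
      + 64 * (3 * j + int k + 2) * zext qa j)"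
    by (simp only: qa_Suc)
  finally have S: "?S (Suc k) = \<dots>" .
  have "(j + 2)^2 * zext qa (j + 2) = 4 * (4 * j + 5) * (4 * j + 7) * zext qa (j + 1)"
    using rec[of "j + 1"] by (simp add: algebra_simps)
  then show "(int n + 2)^3 * zext (\<lambda>j. qa k * qa j) (int n - int k + 2)
     - 2 * (2 * int n + 3) * (32 * (int n + 1) * (int n + 2) + 12) * zext (\<lambda>j. qa k * qa j) (int n - int k + 1)
     + 1024 * (int n + 1) * (2 * int n + 1) * (2 * int n + 3) * zext (\<lambda>j. qa k * qa j) (int n - int k)
     = ?S (Suc k) - ?S k"
    unfolding S z j_def[symmetric] unfolding n using rec[of j] by algebra
qed auto

text \<open>\<open>B n\<close> is the coefficient of x^n in the sum of c k (x (1 - 64 x))^k. The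
  summand moves in the lower binomial index by absorption (\<open>step\<close>) and in
  \<open>k\<close> by Pascal's rule (\<open>pascal\<close>).\<close>

lemma qc_binomial_rec:
  defines "B \<equiv> \<lambda>n. \<Sum>k\<le>n. qc k * (int (k choose (n - k)) * (-64)^(n - k))"
  shows "(int n + 2)^3 * B (n + 2)
    = 2 * (2 * int n + 3) * (32 * (int n + 1) * (int n + 2) + 12) * B (n + 1)
      - 1024 * (int n + 1) * (2 * int n + 1) * (2 * int n + 3) * B n"
  unfolding B_def
proof (rule creative_telescoping)
  define f where "f = (\<lambda>k. zext (\<lambda>j. int (k choose j) * (-64)^j))"
  have z: "zext (\<lambda>j. qc k * (int (k choose j) * (-64)^j)) i = qc k * f k i" for k i
    by (simp add: zext_def f_def)
  \<comment> \<open>With \<open>y = x (1 - 64 x)\<close>, \<open>\<theta> = x d/dx\<close> and \<open>L\<close> the differential operator of the recurrence,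
    \<open>c k L (y^k) = k\<^sup>2 c k \<theta> (y^k) - (k + 1)\<^sup>2 c (k + 1) \<theta> (y^(k + 1))\<close>.\<close>
  let ?S = "\<lambda>k. - (int n + 2) * int k ^ 2 * qc k * f k (int n - int k + 2)"
  fix k
  define j where "j = int n - int k"
  have n: "int n = j + int k" by (simp add: j_def)
  have step: "(i + 1) * f k (i + 1) = -64 * (int k - i) * f k i" for i
    unfolding f_def
  proof (rule zext_first_order[where P = "\<lambda>x. x" and Q = "\<lambda>i. -64 * (int k - i)"])
    fix i
    have "Suc i * (k choose Suc i) = (k - i) * (k choose i)"
      by (metis binomial_absorb_comp binomial_absorption mult.commute)
    then have "int (Suc i) * int (k choose Suc i) = int (k - i) * int (k choose i)"
      by (metis of_nat_mult)
    also have "\<dots> = (int k - int i) * int (k choose i)"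
      by (cases "i \<le> k") (auto simp: of_nat_diff)
    finally have "(int i + 1) * int (k choose Suc i) = (int k - int i) * int (k choose i)"
      by (simp add: add.commute del: binomial_Suc_Suc)
    then show "(int i + 1) * (int (k choose Suc i) * (-64)^Suc i)
        = -64 * (int k - int i) * (int (k choose i) * (-64)^i)"
      by (simp only: power_Suc mult.assoc[symmetric])
  qed simp
  have pascal: "f (Suc k) (i + 1) = f k (i + 1) - 64 * f k i" for i
  proof (cases "i < 0")
    case True
    then show ?thesis by (cases "i = -1") (auto simp: f_def zext_def)
  next
    case False
    then obtain l where "i = int l" by (metis nonneg_int_cases not_less)
    then have "nat (i + 1) = Suc l" "nat i = l" "\<not> i < 0" "\<not> i + 1 < 0" by auto
    then show ?thesis by (simp add: f_def zext_def algebra_simps)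
  qed
  have shift: "int n - int (Suc k) + 2 = j + 1" by (simp add: j_def)
  have "?S (Suc k) = - (int n + 2) * (int k + 1)^2 * qc (Suc k) * (f k (j + 1) - 64 * f k j)"
    unfolding shift pascal by (simp add: add.commute)
  \<comment> \<open>By \<open>step\<close> at \<open>j\<close>, the factor \<open>int n + 2\<close>,
    which is j + k + 2, can be traded for \<open>int k + 1\<close>; this completes the cube that
    \<open>qc_Suc\<close> needs.\<close>
  also have "\<dots> = - ((int k + 1)^3 * qc (Suc k)) * (f k (j + 1) - 128 * f k j)"
    unfolding n using step[of j] by algebra
  finally have S: "?S (Suc k) = - (8 * (2 * int k + 1) * (4 * int k + 1) * (4 * int k + 3) * qc k) * (f k (j + 1) - 128 * f k j)"
    by (simp only: qc_Suc)
  have "(j + 2) * f k (j + 2) = -64 * (int k - j - 1) * f k (j + 1)"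
    using step[of "j + 1"] by (simp add: algebra_simps)
  then show "(int n + 2)^3 * zext (\<lambda>j. qc k * (int (k choose j) * (-64)^j)) (int n - int k + 2)
     - 2 * (2 * int n + 3) * (32 * (int n + 1) * (int n + 2) + 12) * zext (\<lambda>j. qc k * (int (k choose j) * (-64)^j)) (int n - int k + 1)
     + 1024 * (int n + 1) * (2 * int n + 1) * (2 * int n + 3) * zext (\<lambda>j. qc k * (int (k choose j) * (-64)^j)) (int n - int k)
     = ?S (Suc k) - ?S k"
    unfolding S z j_def[symmetric] unfolding n using step[of j] by algebra
qed auto

text \<open>\<open>G n\<close> is the convolution of \<open>cbin k ^ 2\<close> with
  \<open>cbin j * 4 ^ j\<close>, and both factors satisfy first-order recurrences.\<close>

lemma G_rec:
  "(int n + 2)^2 * int (G (n + 2))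
    = (32 * (int n + 1) * (int n + 2) + 12) * int (G (n + 1)) - 256 * (int n + 1)^2 * int (G n)"
proof -
  define e where "e = (\<lambda>j. cbin j * 4 ^ j)"
  have G: "int (G n) = (\<Sum>k\<le>n. cbin k ^ 2 * e (n - k))" for n
    by (auto simp: G_def e_def atMost_atLeast0 diff_mult_distrib2 mult.assoc intro!: sum.cong)
  have e_Suc: "(int j + 1) * e (Suc j) = 8 * (2 * int j + 1) * e j" for j
    by (simp only: e_def power_Suc mult.assoc[symmetric] cbin_Suc)
  show ?thesis
    unfolding G
  proof (rule creative_telescoping)
    \<comment> \<open>With this certificate the coefficient of \<open>zext e (j + 2)\<close> is (n +
      2)^2 - k^2 times \<open>cbin k ^ 2\<close>, a multiple of \<open>j + 2\<close>.\<close>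
    let ?S = "\<lambda>k. - (int k ^ 2) * cbin k ^ 2 * (zext e (int n - int k + 2) - 16 * zext e (int n - int k + 1))"
    have z: "zext (\<lambda>j. cbin k ^ 2 * e j) i = cbin k ^ 2 * zext e i" for k i by (simp add: zext_def)
    fix k
    define j where "j = int n - int k"
    have n: "int n = j + int k" by (simp add: j_def)
    have rec: "(i + 1) * zext e (i + 1) = 8 * (2 * i + 1) * zext e i" for i
      by (rule zext_first_order[where P = "\<lambda>x. x" and Q = "\<lambda>i. 8 * (2 * i + 1)"])
         (simp_all add: e_Suc)
    have shift: "int n - int (Suc k) + 2 = j + 1" "int n - int (Suc k) + 1 = j"
      by (simp_all add: j_def)
    have "?S (Suc k) = - (((int k + 1) * cbin (Suc k)) ^ 2) * (zext e (j + 1) - 16 * zext e j)"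
      unfolding shift power_mult_distrib by (simp add: add.commute del: binomial_Suc_Suc)
    then have S: "?S (Suc k) = - ((2 * (2 * int k + 1) * cbin k) ^ 2) * (zext e (j + 1) - 16 * zext e j)"
      by (simp only: cbin_Suc)
    have "(j + 2) * zext e (j + 2) = 8 * (2 * j + 3) * zext e (j + 1)"
      using rec[of "j + 1"] by (simp add: algebra_simps)
    then show "(int n + 2)^2 * zext (\<lambda>j. cbin k ^ 2 * e j) (int n - int k + 2)
       - (32 * (int n + 1) * (int n + 2) + 12) * zext (\<lambda>j. cbin k ^ 2 * e j) (int n - int k + 1)
       + 256 * (int n + 1)^2 * zext (\<lambda>j. cbin k ^ 2 * e j) (int n - int k)
       = ?S (Suc k) - ?S k"
      unfolding S z j_def[symmetric] unfolding n using rec[of j] by algebra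
  qed auto
qed


text \<open>Multiply \<open>G_rec\<close> by \<open>(N + 2) * b2\<close> and lower the index of the
  central binomial coefficient by \<open>cbin_Suc\<close>, once for the \<open>g1\<close> term and
  twice for the \<open>g0\<close> term.\<close>

lemma central_binomial_G_rec:
  defines "A \<equiv> \<lambda>n. cbin n * int (G n)"
  shows "(int n + 2)^3 * A (n + 2)
    = 2 * (2 * int n + 3) * (32 * (int n + 1) * (int n + 2) + 12) * A (n + 1)
      - 1024 * (int n + 1) * (2 * int n + 1) * (2 * int n + 3) * A n"
proof -
  define N b0 b1 b2 g0 g1 g2 where "N = int n"
    and b: "b0 = cbin n" "b1 = cbin (n + 1)" "b2 = cbin (n + 2)"
    and g: "g0 = int (G n)" "g1 = int (G (n + 1))" "g2 = int (G (n + 2))"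
  have 1: "(N + 1) * b1 = 2 * (2 * N + 1) * b0"
    using cbin_Suc[of n] unfolding b N_def by simp
  have 2: "(N + 2) * b2 = 2 * (2 * N + 3) * b1"
    using cbin_Suc[of "n + 1"] unfolding b N_def by (simp add: algebra_simps del: binomial_Suc_Suc)
  have 3: "(N + 2)^2 * g2 = (32 * (N + 1) * (N + 2) + 12) * g1 - 256 * (N + 1)^2 * g0"
    using G_rec[of n] unfolding g N_def .
  have "(N + 2)^3 * (b2 * g2)
      = 2 * (2 * N + 3) * (32 * (N + 1) * (N + 2) + 12) * (b1 * g1)
        - 1024 * (N + 1) * (2 * N + 1) * (2 * N + 3) * (b0 * g0)"
    using 1 2 3 by algebra
  then show ?thesis unfolding A_def b g N_def .
qed

section \<open>Equality of the three coefficient sequences\<close>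

lemma second_order_rec_unique:
  fixes f g P Q R :: "nat \<Rightarrow> int"
  assumes "\<And>n. R n * f (n + 2) = P n * f (n + 1) - Q n * f n"
    and "\<And>n. R n * g (n + 2) = P n * g (n + 1) - Q n * g n"
    and "\<And>n. R n \<noteq> 0" and "f 0 = g 0" and "f 1 = g 1"
  shows "f n = g n"
proof -
  have "f n = g n \<and> f (n + 1) = g (n + 1)"
  proof (induction n)
    case (Suc n)
    then have "R n * f (n + 2) = R n * g (n + 2)" by (simp only: assms(1,2))
    then show ?case using assms(3)[of n] Suc by simp
  qed (use assms(4,5) in simp)
  then show ?thesis ..
qed

text \<open>This is Clausen's formula combined with a quadratic transformation, 2F1(1/4, 3/4; 1; 64
  x)^2 = 3F2(1/4, 1/2, 3/4; 1, 1; 256 x (1 - 64 x)), read off at x^n.\<close>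

lemma qa_convolution_eq:
  "(\<Sum>k\<le>n. qa k * qa (n - k)) = (\<Sum>k\<le>n. qc k * (int (k choose (n - k)) * (-64)^(n - k)))"
  by (rule second_order_rec_unique[OF qa_convolution_rec qc_binomial_rec])
     (simp_all add: qa_def qc_def numeral_eq_Suc)

lemma central_binomial_G_eq:
  "cbin n * int (G n) = (\<Sum>k\<le>n. qc k * (int (k choose (n - k)) * (-64)^(n - k)))"
  by (rule second_order_rec_unique[OF central_binomial_G_rec qc_binomial_rec])
     (simp_all add: G_def qc_def numeral_eq_Suc)

section \<open>Divisibility of the coefficients by p and its square\<close>

text \<open>A special case of Lucas's theorem, looking only at the last base-p digit. The induction
  uses the absorption identity \<open>eq\<close>, whose factor \<open>Suc L\<close> is prime to
  \<open>p\<close>.\<close>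

lemma prime_dvd_choose_of_mod_less:
  assumes "prime p" and "N mod p < M mod p"
  shows "p dvd (N choose M)"
  using assms(2)
proof (induction N arbitrary: M)
  case 0
  then show ?case by (cases M) auto
next
  case (Suc N)
  then obtain L where M: "M = Suc L" by (cases M) auto
  have pM: "\<not> p dvd Suc L" using Suc.prems M by auto
  have eq: "Suc L * (Suc N choose Suc L) = Suc N * (N choose L)"
    using Suc_times_binomial_eq[of N L] by (simp only: mult.commute)
  have "p dvd Suc N \<or> p dvd (N choose L)"
  proof (cases "p dvd Suc N")
    case False
    \<comment> \<open>Neither \<open>Suc N\<close> nor \<open>Suc L\<close> is a multiple of
      \<open>p\<close>, so both residues drop by exactly one.\<close>
    then have "N mod p < L mod p"
      using Suc.prems M pM by (auto simp: mod_Suc dvd_eq_mod_eq_0 split: if_splits)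
    then show ?thesis using Suc.IH by blast
  qed simp
  then have "p dvd Suc L * (Suc N choose Suc L)" unfolding eq by (metis dvd_mult dvd_mult2)
  then show ?case using assms(1) pM M prime_dvd_mult_iff by blast
qed

lemma prime_dvd_cbin:
  assumes "prime p" and "p \<le> 2 * k" and "k < p"
  shows "int p dvd cbin k"
proof -
  have "(2 * k) mod p = 2 * k - p" using assms by (simp add: mod_if)
  then have "(2 * k) mod p < k mod p" using assms by simp
  then show ?thesis using prime_dvd_choose_of_mod_less assms(1) by auto
qed

lemma prime_sq_dvd_qc:
  assumes "prime p" and "p \<le> 2 * k" and "k < p"
  shows "(int p)\<^sup>2 dvd qc k"
  using prime_dvd_cbin[OF assms] by (simp add: qc_def dvd_power_same)

lemma prime_dvd_qa:
  assumes "prime p" and "p \<le> 4 * k" and "k < p"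
  shows "int p dvd qa k"
proof (cases "p \<le> 2 * k")
  case True
  then show ?thesis using prime_dvd_cbin assms by (simp add: qa_def)
next
  case False
  then show ?thesis using prime_dvd_cbin[of p "2 * k"] assms by (simp add: qa_def)
qed

text \<open>Both factors of \<open>qa k\<close> contribute a \<open>p\<close>: the residues of k, 2k
  and 4k are k, 2k - p and 4k - 3p, which strictly decrease since \<open>k < p\<close>.\<close>

lemma prime_sq_dvd_qa:
  assumes "prime p" and "3 * p \<le> 4 * k" and "k < p"
  shows "(int p)\<^sup>2 dvd qa k"
proof -
  have "(4 * k) mod p = 4 * k - 3 * p"
    by (rule mod_nat_eqI) (use assms in \<open>auto simp: mult.commute\<close>)
  moreover have "(2 * k) mod p = 2 * k - p" using assms by (simp add: mod_if)
  ultimately have "(4 * k) mod p < (2 * k) mod p" using assms by linarith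
  then have "int p dvd cbin (2 * k)"
    using prime_dvd_choose_of_mod_less[OF assms(1)] by auto
  moreover have "int p dvd cbin k" using prime_dvd_cbin assms by simp
  ultimately show ?thesis unfolding qa_def power2_eq_square by (rule mult_dvd_mono[rotated])
qed

text \<open>If one index is below p/4, the other exceeds 3p/4 and its factor supplies the whole
  square; otherwise each factor supplies one \<open>p\<close>.\<close>

lemma prime_sq_dvd_qa_mult_qa:
  assumes "prime p" and "p \<le> i + j" and "i < p" and "j < p"
  shows "(int p)\<^sup>2 dvd qa i * qa j"
proof -
  consider "4 * i < p" | "4 * j < p" | "p \<le> 4 * i" "p \<le> 4 * j" by linarith
  then show ?thesis
  proof cases
    case 1
    then show ?thesis using prime_sq_dvd_qa[of p j] assms by (simp add: dvd_mult)
  next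
    case 2
    then show ?thesis using prime_sq_dvd_qa[of p i] assms by (simp add: dvd_mult2)
  next
    case 3
    then show ?thesis unfolding power2_eq_square
      using prime_dvd_qa assms by (intro mult_dvd_mono) auto
  qed
qed

section \<open>Arithmetic of p-integral rationals\<close>

text \<open>Any fraction with denominator prime to \<open>p\<close> may serve as a witness, reduced
  or not, which makes the closure properties immediate.\<close>

lemma Zp_iff:
  assumes "prime p"
  shows "x \<in> Zp p \<longleftrightarrow> (\<exists>a b. \<not> int p dvd b \<and> x = of_int a / of_int b)"
proof
  assume "x \<in> Zp p"
  then show "\<exists>a b. \<not> int p dvd b \<and> x = of_int a / of_int b"
    by (intro exI[of _ "fst (quotient_of x)"] exI[of _ "snd (quotient_of x)"])
       (simp add: Zp_def quotient_of_div)
next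
  assume "\<exists>a b. \<not> int p dvd b \<and> x = of_int a / of_int b"
  then obtain a b where b: "\<not> int p dvd b" and x: "x = of_int a / of_int b" by blast
  obtain c d where q: "quotient_of x = (c, d)" by force
  have d: "d > 0" "coprime c d" "x = of_int c / of_int d"
    using quotient_of_denom_pos[OF q] quotient_of_coprime[OF q] quotient_of_div[OF q] .
  have "b \<noteq> 0" using b by auto
  then have "rat_of_int (a * d) = of_int (c * b)" using x d by (simp add: field_simps)
  then have eq: "a * d = c * b" by (simp only: of_int_eq_iff)
  have "\<not> int p dvd d"
  proof
    assume "int p dvd d"
    then have "int p dvd c * b" using eq by (metis dvd_mult)
    then have "int p dvd c" using b assms by (simp add: prime_dvd_mult_iff)
    with \<open>int p dvd d\<close> d(2) have "is_unit (int p)" by (metis coprime_common_divisor)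
    then show False using assms not_prime_unit by (simp add: prime_nat_iff)
  qed
  then show "x \<in> Zp p" by (simp add: Zp_def q)
qed

lemma Zp_of_int: "prime p \<Longrightarrow> of_int a \<in> Zp p"
  unfolding Zp_iff by (rule exI[of _ a], rule exI[of _ 1]) (auto simp: prime_nat_iff)

lemma Zp_add:
  assumes "prime p" and "x \<in> Zp p" and "y \<in> Zp p"
  shows "x + y \<in> Zp p"
proof -
  obtain a b c d where *: "\<not> int p dvd b" "x = of_int a / of_int b"
      "\<not> int p dvd d" "y = of_int c / of_int d"
    using assms unfolding Zp_iff[OF assms(1)] by blast
  then have "b \<noteq> 0" "d \<noteq> 0" by auto
  then have "x + y = of_int (a * d + c * b) / of_int (b * d)" using * by (simp add: field_simps)
  moreover have "\<not> int p dvd b * d" using * assms(1) by (simp add: prime_dvd_mult_iff)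
  ultimately show ?thesis unfolding Zp_iff[OF assms(1)] by blast
qed

lemma Zp_mult:
  assumes "prime p" and "x \<in> Zp p" and "y \<in> Zp p"
  shows "x * y \<in> Zp p"
proof -
  obtain a b c d where *: "\<not> int p dvd b" "x = of_int a / of_int b"
      "\<not> int p dvd d" "y = of_int c / of_int d"
    using assms unfolding Zp_iff[OF assms(1)] by blast
  then have "x * y = of_int (a * c) / of_int (b * d)" by simp
  moreover have "\<not> int p dvd b * d" using * assms(1) by (simp add: prime_dvd_mult_iff)
  ultimately show ?thesis unfolding Zp_iff[OF assms(1)] by blast
qed

lemma Zp_power: "prime p \<Longrightarrow> x \<in> Zp p \<Longrightarrow> x ^ n \<in> Zp p"
  using Zp_of_int[of p 1] by (induction n) (auto intro: Zp_mult)

lemma Zp_sum: "prime p \<Longrightarrow> (\<And>i. i \<in> A \<Longrightarrow> f i \<in> Zp p) \<Longrightarrow> sum f A \<in> Zp p"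
  using Zp_of_int[of p 0] by (induction A rule: infinite_finite_induct) (auto intro: Zp_add)

lemma Zp_inverse:
  assumes "prime p" and "m \<in> Zp p" and "\<not> Zp_cong p p m 0"
  shows "m \<noteq> 0" and "1 / m \<in> Zp p"
proof -
  obtain a b where b: "\<not> int p dvd b" "m = of_int a / of_int b"
    using assms(2) unfolding Zp_iff[OF assms(1)] by blast
  have a: "\<not> int p dvd a"
  proof
    assume "int p dvd a"
    then obtain c where "a = int p * c" by auto
    then have "m - 0 = of_nat p * (of_int c / of_int b)" using b by simp
    moreover have "of_int c / of_int b \<in> Zp p" using b unfolding Zp_iff[OF assms(1)] by blast
    moreover have "0 \<in> Zp p" using Zp_of_int[OF assms(1), of 0] by simp
    ultimately have "Zp_cong p p m 0"
      using assms(2) unfolding Zp_cong_def by blast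
    then show False using assms(3) by simp
  qed
  have "1 / m = of_int b / of_int a" using b by simp
  then show "1 / m \<in> Zp p" using a unfolding Zp_iff[OF assms(1)] by blast
  show "m \<noteq> 0" using a b by auto
qed

lemma Zp_multiple_of_dvd:
  assumes "prime p" and "int N dvd c" and "x \<in> Zp p"
  shows "\<exists>z\<in>Zp p. of_int c * x = of_nat N * z"
proof -
  obtain d where "c = int N * d" using assms(2) by auto
  then have "of_int c * x = of_nat N * (of_int d * x)" by simp
  then show ?thesis using Zp_mult Zp_of_int assms by blast
qed

lemma Zp_multiple_sum:
  assumes "prime p" and "\<And>i. i \<in> A \<Longrightarrow> \<exists>z\<in>Zp p. f i = of_nat N * z"
  shows "\<exists>z\<in>Zp p. sum f A = of_nat N * z"
proof -
  obtain z where "\<And>i. i \<in> A \<Longrightarrow> z i \<in> Zp p \<and> f i = of_nat N * z i"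
    using assms(2) by metis
  then have "sum f A = of_nat N * sum z A" "sum z A \<in> Zp p"
    using Zp_sum[OF assms(1), of A z] by (auto simp: sum_distrib_left)
  then show ?thesis by blast
qed

lemma Zp_cong_sym:
  assumes "prime p" and "Zp_cong p n x y"
  shows "Zp_cong p n y x"
proof -
  obtain z where z: "z \<in> Zp p" "x - y = of_nat n * z" using assms(2) by (auto simp: Zp_cong_def)
  then have "y - x = of_nat n * (of_int (- 1) * z)" by (simp add: algebra_simps)
  then show ?thesis using assms z Zp_mult Zp_of_int unfolding Zp_cong_def by blast
qed

lemma Zp_cong_trans:
  assumes "prime p" and "Zp_cong p n x y" and "Zp_cong p n y w"
  shows "Zp_cong p n x w"
proof -
  obtain z1 z2 where z: "z1 \<in> Zp p" "x - y = of_nat n * z1" "z2 \<in> Zp p" "y - w = of_nat n * z2"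
    using assms(2,3) by (auto simp: Zp_cong_def)
  then have "x - w = of_nat n * (z1 + z2)" by (simp add: algebra_simps)
  then show ?thesis using assms z Zp_add unfolding Zp_cong_def by blast
qed

section \<open>Truncated series modulo the square of p\<close>

lemma sum_triangle:
  fixes g :: "nat \<Rightarrow> nat \<Rightarrow> 'a::comm_monoid_add"
  shows "(\<Sum>n<p. \<Sum>k\<le>n. g k (n - k)) = (\<Sum>k<p. \<Sum>j<p - k. g k j)"
proof -
  have "{(i, j). i + j < p} = Sigma {..<p} (\<lambda>i. {..<p - i})" by auto
  then show ?thesis by (simp add: sum.triangle_reindex[symmetric] sum.Sigma)
qed

text \<open>Grouping by \<open>k\<close> leaves \<open>qc k * x ^ k\<close> times the expansion of
  (1 - 64 x)^k cut off at \<open>j < p - k\<close>. For k below p/2 nothing is cut off; for larger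
  \<open>k\<close> the whole term is divisible by the square of \<open>p\<close>.\<close>

lemma sum_central_binomial_G_cong:
  assumes "prime p" and "odd p" and x: "x \<in> Zp p"
  shows "Zp_cong p (p^2) (\<Sum>n<p. of_int (cbin n * int (G n)) * x^n)
           (\<Sum>k\<le>(p - 1) div 2. of_int (qc k) * (x * (1 - 64 * x))^k)"
proof -
  note Zp = Zp_sum[OF assms(1)] Zp_mult[OF assms(1)] Zp_power[OF assms(1)] Zp_of_int[OF assms(1)]
    Zp_add[OF assms(1)]
  define h where "h k j = of_int (int (k choose j)) * (of_int (-64) * x) ^ j" for k j
  define t where "t k = of_int (qc k) * (x ^ k * (\<Sum>j<p - k. h k j))" for k
  have h: "h k j \<in> Zp p" for k j unfolding h_def by (intro Zp x)
  have "(\<Sum>n<p. of_int (cbin n * int (G n)) * x^n)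
      = (\<Sum>n<p. \<Sum>k\<le>n. of_int (qc k) * (x ^ k * h k (n - k)))"
    unfolding central_binomial_G_eq of_int_sum sum_distrib_right
  proof (intro sum.cong refl)
    fix n k :: nat assume "k \<in> {..n}"
    then have "x ^ n = x ^ k * x ^ (n - k)" by (simp flip: power_add)
    then show "of_int (qc k * (int (k choose (n - k)) * (-64)^(n - k))) * x ^ n
        = of_int (qc k) * (x ^ k * h k (n - k))"
      unfolding h_def power_mult_distrib by simp
  qed
  also have "\<dots> = sum t {..<p}"
    unfolding t_def sum_distrib_left
    by (rule sum_triangle[of "\<lambda>k j. of_int (qc k) * (x ^ k * h k j)"])
  finally have T: "(\<Sum>n<p. of_int (cbin n * int (G n)) * x^n) = sum t {..<p}" .
  have S: "of_int (qc k) * (x * (1 - 64 * x))^k = t k" if "k \<le> (p - 1) div 2" for k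
  proof -
    have "(1 - 64 * x)^k = (\<Sum>j\<le>k. h k j)"
      using binomial_ring[of "-64 * x" 1 k] by (simp add: h_def)
    also have "\<dots> = (\<Sum>j<p - k. h k j)"
      \<comment> \<open>As 2k < p, every \<open>j\<close> up to \<open>k\<close> is below
        \<open>p - k\<close>; the additional \<open>j\<close> have
        \<open>k choose j = 0\<close>.\<close>
      by (rule sum.mono_neutral_left) (use that assms(2) in \<open>auto simp: h_def elim!: oddE\<close>)
    finally show ?thesis by (simp add: t_def power_mult_distrib)
  qed
  have "sum t {..<p} = sum t {..(p - 1) div 2} + sum t {(p - 1) div 2<..<p}"
    using prime_gt_0_nat[OF assms(1)] by (subst sum.union_disjoint[symmetric]) (auto intro!: sum.cong)
  moreover have "\<exists>z\<in>Zp p. sum t {(p - 1) div 2<..<p} = of_nat (p^2) * z"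
  proof (rule Zp_multiple_sum[OF assms(1)])
    fix k assume "k \<in> {(p - 1) div 2<..<p}"
    then have "int (p^2) dvd qc k" using prime_sq_dvd_qc[of p k] assms by auto
    then show "\<exists>z\<in>Zp p. t k = of_nat (p^2) * z"
      unfolding t_def by (rule Zp_multiple_of_dvd[OF assms(1)]) (intro Zp x h)
  qed
  moreover have "t k \<in> Zp p" for k unfolding t_def by (intro Zp x h)
  ultimately show ?thesis
    unfolding Zp_cong_def T using S by (auto intro: Zp)
qed

text \<open>The square of the truncated series runs over all \<open>i, j < p\<close>, the other side
  only over the triangle i + j < p. The remaining corner is handled by
  \<open>prime_sq_dvd_qa_mult_qa\<close>.\<close>

lemma sum_central_binomial_G_cong_square:
  assumes "prime p" and x: "x \<in> Zp p"
  shows "Zp_cong p (p^2) ((\<Sum>k<p. of_int (qa k) * x^k)^2)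
           (\<Sum>n<p. of_int (cbin n * int (G n)) * x^n)"
proof -
  note Zp = Zp_sum[OF assms(1)] Zp_mult[OF assms(1)] Zp_power[OF assms(1)] Zp_of_int[OF assms(1)]
  define t where "t i j = of_int (qa i * qa j) * x ^ (i + j)" for i j
  have "(\<Sum>n<p. of_int (cbin n * int (G n)) * x^n) = (\<Sum>n<p. \<Sum>k\<le>n. t k (n - k))"
    unfolding central_binomial_G_eq qa_convolution_eq[symmetric] of_int_sum sum_distrib_right t_def
    by (intro sum.cong) auto
  then have T: "(\<Sum>n<p. of_int (cbin n * int (G n)) * x^n) = (\<Sum>i<p. \<Sum>j<p - i. t i j)"
    by (simp only: sum_triangle)
  have "(\<Sum>k<p. of_int (qa k) * x^k)^2 = (\<Sum>i<p. \<Sum>j<p. t i j)"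
    by (simp add: power2_eq_square sum_product t_def power_add algebra_simps)
  also have "\<dots> = (\<Sum>i<p. (\<Sum>j<p - i. t i j) + (\<Sum>j\<in>{p - i..<p}. t i j))"
    by (intro sum.cong refl) (subst sum.union_disjoint[symmetric], auto intro!: sum.cong)
  finally have "(\<Sum>k<p. of_int (qa k) * x^k)^2 - (\<Sum>i<p. \<Sum>j<p - i. t i j)
      = (\<Sum>i<p. \<Sum>j\<in>{p - i..<p}. t i j)"
    by (simp add: sum.distrib)
  moreover have "\<exists>z\<in>Zp p. (\<Sum>i<p. \<Sum>j\<in>{p - i..<p}. t i j) = of_nat (p^2) * z"
  proof (intro Zp_multiple_sum[OF assms(1)])
    fix i j assume "i \<in> {..<p}" "j \<in> {p - i..<p}"
    then have "int (p^2) dvd qa i * qa j" using prime_sq_dvd_qa_mult_qa[of p i j] assms by auto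
    then show "\<exists>z\<in>Zp p. t i j = of_nat (p^2) * z"
      unfolding t_def by (rule Zp_multiple_of_dvd[OF assms(1)]) (intro Zp x)
  qed
  moreover have "t i j \<in> Zp p" for i j unfolding t_def by (intro Zp x)
  ultimately show ?thesis
    unfolding Zp_cong_def T by (auto intro!: Zp x)
qed

theorem theorem2p3:
  fixes p :: nat and m :: rat
  assumes "prime p" and "odd p"
    and "m \<in> Zp p" and "\<not> Zp_cong p p m 0"
  shows "Zp_cong p (p^2)
           (\<Sum>n=0..p-1. of_nat (((2*n) choose n) * G n) / m^n)
           (\<Sum>k=0..(p-1) div 2.
              of_nat (((2*k) choose k)^2 * ((4*k) choose (2*k))) * ((m - 64) / m^2)^k)
       \<and> Zp_cong p (p^2)
           (\<Sum>k=0..(p-1) div 2.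
              of_nat (((2*k) choose k)^2 * ((4*k) choose (2*k))) * ((m - 64) / m^2)^k)
           ((\<Sum>k=0..p-1. of_nat (((2*k) choose k) * ((4*k) choose (2*k))) / m^k)^2)"
    (is "Zp_cong p _ ?T ?S \<and> Zp_cong p _ ?S (?R^2)")
proof -
  note m = Zp_inverse[OF assms(1,3,4)]
  have range: "{0..p-1} = {..<p}" using prime_gt_0_nat[OF assms(1)] by auto
  have arg: "(m - 64) / m^2 = 1 / m * (1 - 64 * (1 / m))"
    using m(1) by (simp add: field_simps power2_eq_square)
  have T: "?T = (\<Sum>n<p. of_int (cbin n * int (G n)) * (1 / m)^n)"
    unfolding range by (intro sum.cong) (simp_all add: power_one_over divide_simps)
  have S: "?S = (\<Sum>k\<le>(p - 1) div 2. of_int (qc k) * (1 / m * (1 - 64 * (1 / m)))^k)"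
    unfolding arg atLeast0AtMost by (intro sum.cong) (simp_all add: qc_def)
  have R: "?R = (\<Sum>k<p. of_int (qa k) * (1 / m)^k)"
    unfolding range by (intro sum.cong) (simp_all add: qa_def power_one_over divide_simps)
  have 1: "Zp_cong p (p^2) ?T ?S"
    unfolding T S using sum_central_binomial_G_cong[OF assms(1,2) m(2)] .
  have 2: "Zp_cong p (p^2) (?R^2) ?T"
    unfolding T R using sum_central_binomial_G_cong_square[OF assms(1) m(2)] .
  \<comment> \<open>The second congruence passes through \<open>?T\<close>, to which both other sums
    have been compared.\<close>
  show ?thesis
    using 1 Zp_cong_sym[OF assms(1) Zp_cong_trans[OF assms(1) 2 1]] by blast
qed

end
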